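(* Let $X_1, X_2, \ldots$ be independent and identically distributed real-valued random variables on a probability space with probability measure $\mathbf{P}$, with finite mean (that is, $\mathbf{E}|X_1| < \infty$). For each $n \in \mathbf{N} = \{1,2,3,\ldots\}$, let $S_n := X_1 + \cdots + X_n$. Then $S_n/n \to \mathbf{E}[X_1]$ as $n \to \infty$ with probability $1$.
   Context: $\mathbf{N}$ denotes the set of positive integers, $\mathbf{P}$ the probability measure, and $\mathbf{E}$ the expectation with respect to $\mathbf{P}$. *)

theory Defs
  imports "HOL-Probability.Probability"
begin

end

theory Submission
  imports Defs
begin

text \<open>
  Etemadi's argument. Truncating the first \<open>n\<close> variables at level \<open>n\<close>, a union bound and
  Chebyshev's inequality control the deviation probability of \<open>S\<^sub>n / n\<close> by a multiple of
  \<open>E min(n, X\<^sub>1\<^sup>2 / n)\<close>. Along \<open>n = \<lceil>\<alpha>^j\<rceil>\<close> these bounds are summable, because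
  \<open>\<Sum>\<^sub>j min(\<alpha>^j, y\<^sup>2 / \<alpha>^j)\<close> is at most a constant times \<open>y\<close>; so the averages converge almost
  surely along this subsequence. For nonnegative variables the partial sums are monotone, which
  fills the gaps up to a factor \<open>\<alpha>\<close>, and \<open>\<alpha>\<close> may be taken arbitrarily close to \<open>1\<close>. The
  general case is the difference of the positive and the negative part.
\<close>

section \<open>Summing the truncated second moment along a geometric sequence\<close>

text \<open>
  The bounded function \<open>t \<mapsto> y t / (t + y)\<close> is chosen because its increment over one geometric
  step is comparable to \<open>min(t, y\<^sup>2 / t)\<close>, so that the sum over \<open>t = a^n\<close> telescopes.
\<close>

lemma min_power_telescope:
  fixes a t y :: real
  assumes "a > 1" "t > 0" "y \<ge> 0"
  shows "min t (y\<^sup>2 / t) \<le> 2 * (a + 1) / (a - 1) * (y * (a * t) / (a * t + y) - y * t / (t + y))"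
proof -
  define m where "m = min t (y\<^sup>2 / t)"
  have m: "m \<ge> 0" "m \<le> t" "m * t \<le> y\<^sup>2"
    using assms by (auto simp: m_def min_def field_simps)
  \<comment> \<open>A minimum is at most the geometric mean of its two arguments, here
    \<open>t\<close> and \<open>y\<^sup>2 / t\<close>, whose product is
    \<open>y\<^sup>2\<close>.\<close>
  have "m * m \<le> y\<^sup>2"
    using m mult_left_mono[of m t m] by linarith
  then have my: "m \<le> y"
    using assms(3) by (metis power2_eq_square power2_le_imp_le)
  have pos: "a * t + y > 0" "t + y > 0"
    using assms by (auto intro!: add_pos_nonneg)
  \<comment> \<open>After clearing denominators each group of terms gets its own bound:
    \<open>m * t \<le> y\<^sup>2\<close> for the first, \<open>m \<le> y\<close> for the middle one,
    \<open>m \<le> t\<close> for the last. Each then becomes a multiple of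
    \<open>y\<^sup>2 * t\<close>, and the coefficients add up to \<open>2 * (a + 1)\<close>.\<close>
  have "m * ((a * t + y) * (t + y)) = a * t * (m * t) + (a + 1) * t * y * m + y\<^sup>2 * m"
    by (simp add: algebra_simps power2_eq_square)
  also have "\<dots> \<le> a * t * y\<^sup>2 + (a + 1) * t * y * y + y\<^sup>2 * t"
    using m my assms by (intro add_mono mult_left_mono) auto
  also have "\<dots> = 2 * (a + 1) * (y\<^sup>2 * t)"
    by (simp add: algebra_simps power2_eq_square)
  finally have "m \<le> 2 * (a + 1) * (y\<^sup>2 * t) / ((a * t + y) * (t + y))"
    using pos by (simp add: pos_le_divide_eq)
  also have "\<dots> = 2 * (a + 1) / (a - 1) * ((a - 1) * (y\<^sup>2 * t) / ((a * t + y) * (t + y)))"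
    using assms(1) by simp
  also have "(a - 1) * (y\<^sup>2 * t) / ((a * t + y) * (t + y)) = y * (a * t) / (a * t + y) - y * t / (t + y)"
    using pos by (subst diff_frac_eq) (auto simp: algebra_simps power2_eq_square)
  finally show ?thesis
    unfolding m_def .
qed

text \<open>The telescoped function takes values between 0 and \<open>y\<close>, so its total
  increment is at most \<open>y\<close>, whatever the number of terms.\<close>

lemma sum_min_power_le:
  fixes a y :: real
  assumes "a > 1" "y \<ge> 0"
  shows "(\<Sum>n<N. min (a ^ n) (y\<^sup>2 / a ^ n)) \<le> 2 * (a + 1) / (a - 1) * y"
proof -
  define \<phi> where "\<phi> n = y * a ^ n / (a ^ n + y)" for n
  have "(\<Sum>n<N. min (a ^ n) (y\<^sup>2 / a ^ n)) \<le> (\<Sum>n<N. 2 * (a + 1) / (a - 1) * (\<phi> (Suc n) - \<phi> n))"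
    using min_power_telescope[OF assms(1) _ assms(2)] assms(1)
    by (intro sum_mono) (auto simp: \<phi>_def)
  also have "\<dots> = 2 * (a + 1) / (a - 1) * (\<phi> N - \<phi> 0)"
    by (simp only: sum_lessThan_telescope flip: sum_distrib_left)
  also have "\<dots> \<le> 2 * (a + 1) / (a - 1) * y"
  proof (rule mult_left_mono)
    have "a ^ N + y > 0"
      using assms by (intro add_pos_nonneg) auto
    then have "\<phi> N \<le> y"
      using assms by (simp add: \<phi>_def divide_le_eq algebra_simps)
    moreover have "\<phi> 0 \<ge> 0"
      using assms by (simp add: \<phi>_def)
    ultimately show "\<phi> N - \<phi> 0 \<le> y"
      by linarith
  qed (use assms in auto)
  finally show ?thesis .
qed

section \<open>Geometric subsequences of the positive integers\<close>

definition ceil_pow :: "real \<Rightarrow> nat \<Rightarrow> nat" where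
  "ceil_pow a n = nat \<lceil>a ^ n\<rceil>"

lemma ceil_pow_bounds:
  assumes "a > 1"
  shows "a ^ n \<le> real (ceil_pow a n)" "real (ceil_pow a n) \<le> a ^ n + 1"
    "real (ceil_pow a n) \<le> 2 * a ^ n" "ceil_pow a n \<ge> 1"
proof -
  have "a ^ n \<ge> 1"
    using assms by simp
  then have c: "real (ceil_pow a n) = of_int \<lceil>a ^ n\<rceil>"
    unfolding ceil_pow_def by (intro of_nat_nat) linarith
  show "a ^ n \<le> real (ceil_pow a n)" "real (ceil_pow a n) \<le> a ^ n + 1"
    unfolding c by linarith+
  with \<open>a ^ n \<ge> 1\<close> show "real (ceil_pow a n) \<le> 2 * a ^ n" "ceil_pow a n \<ge> 1"
    by linarith+
qed

lemma filterlim_ceil_pow: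
  assumes "a > 1"
  shows "filterlim (ceil_pow a) at_top sequentially"
proof -
  have "filterlim (\<lambda>n. a ^ n) at_top sequentially"
    using filterlim_realpow_sequentially_gt1[of a] assms
    by (auto simp: filterlim_at_infinity_conv_norm_at_top)
  then have "filterlim (\<lambda>n. real (ceil_pow a n)) at_top sequentially"
    by (rule filterlim_at_top_mono) (simp add: ceil_pow_bounds(1)[OF assms])
  then show ?thesis
    by (simp add: filterlim_sequentially_iff_filterlim_real)
qed

text \<open>Rounding adds at most 1, a relative error of at most \<open>(1 / a) ^ n\<close>. Hence
  \<open>ceil_pow a n\<close> is asymptotic to \<open>a ^ n\<close>, and consecutive quotients have
  the same limit as those of the exact powers.\<close>

lemma ceil_pow_Suc_ratio:
  assumes "a > 1"
  shows "(\<lambda>n. real (ceil_pow a (Suc n)) / real (ceil_pow a n)) \<longlonglongrightarrow> a"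
proof -
  have lim: "(\<lambda>n. real (ceil_pow a n) / a ^ n) \<longlonglongrightarrow> 1"
  proof (rule tendsto_sandwich)
    show "\<forall>\<^sub>F n in sequentially. 1 \<le> real (ceil_pow a n) / a ^ n"
      using ceil_pow_bounds(1)[OF assms] assms by (intro always_eventually) (simp add: le_divide_eq)
    show "\<forall>\<^sub>F n in sequentially. real (ceil_pow a n) / a ^ n \<le> 1 + (1 / a) ^ n"
      using ceil_pow_bounds(2)[OF assms] assms
      by (intro always_eventually) (simp add: divide_le_eq algebra_simps power_divide)
    have "(\<lambda>n. 1 + (1 / a) ^ n) \<longlonglongrightarrow> 1 + 0"
      using assms by (intro tendsto_intros LIMSEQ_realpow_zero) auto
    then show "(\<lambda>n. 1 + (1 / a) ^ n) \<longlonglongrightarrow> 1"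
      by simp
  qed simp
  have "(\<lambda>n. a * ((real (ceil_pow a (Suc n)) / a ^ Suc n) / (real (ceil_pow a n) / a ^ n)))
      \<longlonglongrightarrow> a * (1 / 1)"
    by (intro tendsto_intros lim LIMSEQ_Suc[OF lim]) simp
  also have "(\<lambda>n. a * ((real (ceil_pow a (Suc n)) / a ^ Suc n) / (real (ceil_pow a n) / a ^ n)))
      = (\<lambda>n. real (ceil_pow a (Suc n)) / real (ceil_pow a n))"
  proof
    fix n
    show "a * ((real (ceil_pow a (Suc n)) / a ^ Suc n) / (real (ceil_pow a n) / a ^ n))
      = real (ceil_pow a (Suc n)) / real (ceil_pow a n)"
      using assms by simp
  qed
  finally show ?thesis
    by simp
qed

text \<open>Rounding up at most doubles the first argument of the minimum and does not increase the
  second, so passing to integers costs a factor 2 only.\<close>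

lemma sum_min_ceil_pow_le:
  assumes "a > 1"
  shows "(\<Sum>n<N. min (real (ceil_pow a n)) (x\<^sup>2 / real (ceil_pow a n)))
    \<le> 4 * (a + 1) / (a - 1) * \<bar>x\<bar>"
proof -
  have "(\<Sum>n<N. min (real (ceil_pow a n)) (x\<^sup>2 / real (ceil_pow a n)))
      \<le> (\<Sum>n<N. 2 * min (a ^ n) (\<bar>x\<bar>\<^sup>2 / a ^ n))"
  proof (rule sum_mono)
    fix n
    have "x\<^sup>2 / real (ceil_pow a n) \<le> x\<^sup>2 / a ^ n" "x\<^sup>2 / a ^ n \<ge> 0"
      using ceil_pow_bounds(1,4)[OF assms, of n] assms by (auto intro!: divide_left_mono mult_pos_pos)
    then show "min (real (ceil_pow a n)) (x\<^sup>2 / real (ceil_pow a n)) \<le> 2 * min (a ^ n) (\<bar>x\<bar>\<^sup>2 / a ^ n)"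
      using ceil_pow_bounds(3)[OF assms, of n]
      unfolding power2_abs by linarith
  qed
  also have "\<dots> = 2 * (\<Sum>n<N. min (a ^ n) (\<bar>x\<bar>\<^sup>2 / a ^ n))"
    by (rule sum_distrib_left[symmetric])
  also have "\<dots> \<le> 2 * (2 * (a + 1) / (a - 1) * \<bar>x\<bar>)"
    using sum_min_power_le[OF assms, of "\<bar>x\<bar>" N] by (intro mult_left_mono) auto
  finally show ?thesis
    by (simp add: algebra_simps)
qed

text \<open>This turns a property of all late subsequence indices into one available for all large
  \<open>m\<close>, by bracketing \<open>m\<close> between two consecutive subsequence
  terms.\<close>

lemma eventually_between_ceil_pow:
  assumes a: "a > 1" and ev: "eventually P sequentially"
  shows "\<forall>\<^sub>F m in sequentially. \<exists>n. P n \<and> ceil_pow a n \<le> m \<and> m < ceil_pow a (Suc n)"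
proof -
  obtain N where N: "\<And>n. n \<ge> N \<Longrightarrow> P n"
    using ev by (auto simp: eventually_sequentially)
  show ?thesis
  proof (rule eventually_sequentiallyI[of "ceil_pow a N"])
    fix m assume m: "m \<ge> ceil_pow a N"
    obtain n where n: "n \<ge> N" "m < ceil_pow a n"
    proof -
      have "\<forall>\<^sub>F n in sequentially. Suc m \<le> ceil_pow a n \<and> N \<le> n"
        using filterlim_ceil_pow[OF a] eventually_ge_at_top[of N]
        by (intro eventually_conj) (auto simp only: filterlim_at_top)
      then show thesis
        using that by (auto simp: eventually_sequentially Suc_le_eq)
    qed
    \<comment> \<open>The least index from \<open>N\<close> on whose term exceeds \<open>m\<close>
      cannot be \<open>N\<close>, as \<open>ceil_pow a N \<le> m\<close>. Its predecessor is
      therefore still at least \<open>N\<close>, and by minimality its term is at most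
      \<open>m\<close>.\<close>
    define l where "l = (LEAST n. N \<le> n \<and> m < ceil_pow a n)"
    have l: "N \<le> l" "m < ceil_pow a l"
      using LeastI[of "\<lambda>n. N \<le> n \<and> m < ceil_pow a n" n] n by (auto simp: l_def)
    then have "l > N"
      using m by (metis le_neq_implies_less not_le)
    then obtain l' where l': "l = Suc l'" "N \<le> l'"
      by (metis less_Suc_eq_le not0_implies_Suc not_less_zero)
    then have "\<not> (N \<le> l' \<and> m < ceil_pow a l')"
      unfolding l_def by (metis lessI not_less_Least l_def)
    then show "\<exists>n. P n \<and> ceil_pow a n \<le> m \<and> m < ceil_pow a (Suc n)"
      using l l' N by (intro exI[of _ l']) auto
  qed
qed

section \<open>Filling the gaps for monotone partial sums\<close>

text \<open>With k and k' consecutive subsequence terms and k <= m < k', monotonicity gives s(k)/k'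
  <= s(m)/m <= s(k')/k. The outer terms tend to \<mu>/a and \<mu>*a. The ratios a = 1 + 1/(j+1) come
  arbitrarily close to 1 and form a countable family, so that almost sure hypotheses can be
  combined.\<close>

lemma mono_average_tendsto:
  fixes s :: "nat \<Rightarrow> real"
  assumes mono: "mono s" and nonneg: "\<And>n. s n \<ge> 0"
    and lim: "\<And>j. (\<lambda>n. s (ceil_pow (1 + 1 / real (Suc j)) n)
      / real (ceil_pow (1 + 1 / real (Suc j)) n)) \<longlonglongrightarrow> \<mu>"
  shows "(\<lambda>n. s n / real n) \<longlonglongrightarrow> \<mu>"
proof (rule order_tendstoI)
  have inv: "(\<lambda>j. 1 + 1 / real (Suc j)) \<longlonglongrightarrow> 1 + 0"
    by (intro tendsto_intros LIMSEQ_Suc[OF lim_1_over_n])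
  fix b
  {
    assume "b < \<mu>"
    \<comment> \<open>Fix the ratio so close to 1 that the lower limit \<mu>/a still exceeds
      \<open>b\<close>.\<close>
    have "(\<lambda>j. \<mu> / (1 + 1 / real (Suc j))) \<longlonglongrightarrow> \<mu> / (1 + 0)"
      by (intro tendsto_intros inv) auto
    then have "\<forall>\<^sub>F j in sequentially. b < \<mu> / (1 + 1 / real (Suc j))"
      using \<open>b < \<mu>\<close> by (intro order_tendstoD(1)) auto
    then obtain j where j: "b < \<mu> / (1 + 1 / real (Suc j))"
      using eventually_happens' sequentially_bot by blast
    define a where "a = 1 + 1 / real (Suc j)"
    have a: "a > 1"
      by (simp add: a_def)
    note k = ceil_pow_bounds(4)[OF a]
    have "(\<lambda>n. (s (ceil_pow a n) / real (ceil_pow a n))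
        / (real (ceil_pow a (Suc n)) / real (ceil_pow a n))) \<longlonglongrightarrow> \<mu> / a"
      using a lim[of j, folded a_def] by (intro tendsto_divide ceil_pow_Suc_ratio) auto
    then have "\<forall>\<^sub>F n in sequentially. b < (s (ceil_pow a n) / real (ceil_pow a n))
        / (real (ceil_pow a (Suc n)) / real (ceil_pow a n))"
      using j by (intro order_tendstoD(1)) (auto simp: a_def)
    from eventually_between_ceil_pow[OF a this]
    show "\<forall>\<^sub>F m in sequentially. b < s m / real m"
    proof (rule eventually_mono)
      fix m assume "\<exists>n. b < s (ceil_pow a n) / real (ceil_pow a n)
        / (real (ceil_pow a (Suc n)) / real (ceil_pow a n))
        \<and> ceil_pow a n \<le> m \<and> m < ceil_pow a (Suc n)"
      then obtain n where n: "b < s (ceil_pow a n) / real (ceil_pow a n)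
        / (real (ceil_pow a (Suc n)) / real (ceil_pow a n))"
        "ceil_pow a n \<le> m" "m < ceil_pow a (Suc n)"
        by blast
      note n(1)
      also have "s (ceil_pow a n) / real (ceil_pow a n)
        / (real (ceil_pow a (Suc n)) / real (ceil_pow a n)) = s (ceil_pow a n) / real (ceil_pow a (Suc n))"
        using k[of n] by simp
      also have "\<dots> \<le> s m / real m"
        using n k[of n] monoD[OF mono n(2)] nonneg by (intro frac_le) auto
      finally show "b < s m / real m" .
    qed
  next
    assume "b > \<mu>"
    \<comment> \<open>Symmetrically, choose the ratio so that the upper limit \<mu>*a stays below
      \<open>b\<close>.\<close>
    have "(\<lambda>j. \<mu> * (1 + 1 / real (Suc j))) \<longlonglongrightarrow> \<mu> * (1 + 0)"
      by (intro tendsto_intros inv)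
    then have "\<forall>\<^sub>F j in sequentially. b > \<mu> * (1 + 1 / real (Suc j))"
      using \<open>b > \<mu>\<close> by (intro order_tendstoD(2)) auto
    then obtain j where j: "b > \<mu> * (1 + 1 / real (Suc j))"
      using eventually_happens' sequentially_bot by blast
    define a where "a = 1 + 1 / real (Suc j)"
    have a: "a > 1"
      by (simp add: a_def)
    note k = ceil_pow_bounds(4)[OF a]
    have "(\<lambda>n. (s (ceil_pow a (Suc n)) / real (ceil_pow a (Suc n)))
        * (real (ceil_pow a (Suc n)) / real (ceil_pow a n))) \<longlonglongrightarrow> \<mu> * a"
      using a LIMSEQ_Suc[OF lim[of j, folded a_def]] by (intro tendsto_mult ceil_pow_Suc_ratio) auto
    then have "\<forall>\<^sub>F n in sequentially. b > (s (ceil_pow a (Suc n)) / real (ceil_pow a (Suc n)))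
        * (real (ceil_pow a (Suc n)) / real (ceil_pow a n))"
      using j by (intro order_tendstoD(2)) (auto simp: a_def)
    from eventually_between_ceil_pow[OF a this]
    show "\<forall>\<^sub>F m in sequentially. s m / real m < b"
    proof (rule eventually_mono)
      fix m assume "\<exists>n. s (ceil_pow a (Suc n)) / real (ceil_pow a (Suc n))
        * (real (ceil_pow a (Suc n)) / real (ceil_pow a n)) < b
        \<and> ceil_pow a n \<le> m \<and> m < ceil_pow a (Suc n)"
      then obtain n where n: "s (ceil_pow a (Suc n)) / real (ceil_pow a (Suc n))
        * (real (ceil_pow a (Suc n)) / real (ceil_pow a n)) < b"
        "ceil_pow a n \<le> m" "m < ceil_pow a (Suc n)"
        by blast
      have "s m / real m \<le> s (ceil_pow a (Suc n)) / real (ceil_pow a n)"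
        using n k[of n] monoD[OF mono, of m "ceil_pow a (Suc n)"] nonneg by (intro frac_le) auto
      also have "\<dots> = s (ceil_pow a (Suc n)) / real (ceil_pow a (Suc n))
        * (real (ceil_pow a (Suc n)) / real (ceil_pow a n))"
        using k[of "Suc n"] by simp
      also note n(1)
      finally show "s m / real m < b" .
    qed
  }
qed

section \<open>Deviation bounds by truncation\<close>

context prob_space
begin

text \<open>The two claims are proved in one induction: expanding the variance after adding a
  variable requires the partial sum to be square integrable.\<close>

lemma
  fixes X :: "'i \<Rightarrow> 'a \<Rightarrow> real"
  assumes fin: "finite I" and indep: "indep_vars (\<lambda>_. borel) X I"
    and sq: "\<And>i. i \<in> I \<Longrightarrow> integrable M (\<lambda>\<omega>. (X i \<omega>)\<^sup>2)"
  shows integrable_sum_power2_indep: "integrable M (\<lambda>\<omega>. (\<Sum>i\<in>I. X i \<omega>)\<^sup>2)" (is ?int)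
    and variance_sum_indep: "variance (\<lambda>\<omega>. \<Sum>i\<in>I. X i \<omega>) = (\<Sum>i\<in>I. variance (X i))" (is ?var)
proof -
  have "?int \<and> ?var"
    using fin indep sq
  proof (induction I rule: finite_induct)
    case (insert i I)
    define T where "T = (\<lambda>\<omega>. \<Sum>i\<in>I. X i \<omega>)"
    have ind: "indep_vars (\<lambda>_. borel) X I"
      using insert.prems(1) by (rule indep_vars_subset) auto
    have rv: "random_variable borel (X j)" if "j \<in> insert i I" for j
      using insert.prems(1) that by (auto simp: indep_vars_def)
    have [measurable]: "random_variable borel (X i)" "random_variable borel T"
      using rv by (auto simp: T_def)
    have sqi: "integrable M (\<lambda>\<omega>. (X i \<omega>)\<^sup>2)" and sqT: "integrable M (\<lambda>\<omega>. (T \<omega>)\<^sup>2)"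
      and varT: "variance T = (\<Sum>j\<in>I. variance (X j))"
      using insert.prems(2) insert.IH[OF ind] by (auto simp: T_def)
    have int: "integrable M (X i)" "integrable M T"
      using sqi sqT by (auto intro: square_integrable_imp_integrable)
    have "indep_var borel (X i) borel T"
      unfolding T_def using insert by (intro indep_vars_sum) auto
    \<comment> \<open>By independence the expectation of the cross term factors, so it cancels
      against the cross term of the squared mean.\<close>
    note prod = indep_var_integrable[OF this int] indep_var_lebesgue_integral[OF this int]
    have eq: "(\<lambda>\<omega>. (X i \<omega> + T \<omega>)\<^sup>2) = (\<lambda>\<omega>. (X i \<omega>)\<^sup>2 + 2 * (X i \<omega> * T \<omega>) + (T \<omega>)\<^sup>2)"
      by (auto simp: power2_sum)
    have int2: "integrable M (\<lambda>\<omega>. (X i \<omega> + T \<omega>)\<^sup>2)"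
      unfolding eq using sqi sqT prod(1) by auto
    have "variance (\<lambda>\<omega>. X i \<omega> + T \<omega>)
        = expectation (\<lambda>\<omega>. (X i \<omega> + T \<omega>)\<^sup>2) - (expectation (\<lambda>\<omega>. X i \<omega> + T \<omega>))\<^sup>2"
      using int int2 by (intro variance_eq) auto
    also have "\<dots> = variance (X i) + variance T"
      unfolding eq variance_eq[OF int(1) sqi] variance_eq[OF int(2) sqT]
      using int sqi sqT prod by (simp add: power2_sum)
    finally have "variance (\<lambda>\<omega>. X i \<omega> + T \<omega>) = variance (X i) + (\<Sum>j\<in>I. variance (X j))"
      using varT by simp
    with int2 show ?case
      using insert.hyps by (simp add: T_def)
  qed simp
  then show ?int ?var
    by auto
qed

lemma expectation_cong_distr:
  fixes f :: "real \<Rightarrow> real"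
  assumes [measurable]: "random_variable borel Y" "random_variable borel Z" "f \<in> borel_measurable borel"
    and "distr M borel Y = distr M borel Z"
  shows "expectation (\<lambda>\<omega>. f (Y \<omega>)) = expectation (\<lambda>\<omega>. f (Z \<omega>))"
  using integral_distr[of Y M borel f] integral_distr[of Z M borel f] assms(4) by simp

text \<open>The deviation is measured from the truncated mean. Chebyshev for the truncated sum
  contributes the \<open>1 / e\<^sup>2\<close>; the event that some variable exceeds the truncation
  level contributes the 1.\<close>

lemma iid_average_deviation:
  fixes X :: "nat \<Rightarrow> 'a \<Rightarrow> real"
  assumes indep: "indep_vars (\<lambda>_. borel) X {1..}"
    and ident: "\<And>n. n \<ge> 1 \<Longrightarrow> distr M borel (X n) = distr M borel (X 1)"
    and n: "n \<ge> 1" and e: "e > 0"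
  defines "t \<equiv> \<lambda>x::real. if \<bar>x\<bar> \<le> real n then x else 0"
  shows "prob {\<omega> \<in> space M. \<bar>(\<Sum>i=1..n. X i \<omega>) / real n - expectation (\<lambda>\<omega>. t (X 1 \<omega>))\<bar> \<ge> e}
    \<le> (1 + 1 / e\<^sup>2) * expectation (\<lambda>\<omega>. min (real n) ((X 1 \<omega>)\<^sup>2 / real n))"
proof -
  have rv [measurable]: "random_variable borel (X i)" if "i \<ge> 1" for i
    using indep that by (auto simp: indep_vars_def)
  have [measurable]: "random_variable borel (X 1)" "random_variable borel (X (Suc 0))"
    using rv[of 1] by auto
  have expectation_ident: "expectation (\<lambda>\<omega>. f (X i \<omega>)) = expectation (\<lambda>\<omega>. f (X 1 \<omega>))"
    if "i \<ge> 1" "f \<in> borel_measurable borel" for f :: "real \<Rightarrow> real" and i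
    by (rule expectation_cong_distr[OF rv[OF that(1)] rv[of 1] that(2) ident[OF that(1)]]) simp
  have t_meas [measurable]: "t \<in> borel_measurable borel"
    unfolding t_def by measurable
  \<comment> \<open>\<open>h\<close> serves both estimates: it equals
    \<open>x\<^sup>2 / real n\<close> up to the truncation level and \<open>real n\<close> beyond
    it. So \<open>real n * h\<close> dominates the truncated square, and \<open>h\<close> dominates
    \<open>real n\<close> times the tail indicator.\<close>
  define h where "h x = min (real n) (x\<^sup>2 / real n)" for x :: real
  have [measurable]: "h \<in> borel_measurable borel"
    unfolding h_def by measurable
  have npos: "real n > 0"
    using n by simp
  have h_nonneg: "h x \<ge> 0" for x
    by (simp add: h_def)
  have int_h: "integrable M (\<lambda>\<omega>. h (X 1 \<omega>))"
    by (rule integrable_const_bound[of _ "real n"]) (use h_nonneg in \<open>auto simp: h_def\<close>)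
  have bound_t: "\<bar>t x\<bar> \<le> real n" for x
    by (auto simp: t_def)
  have t_sq: "(t x)\<^sup>2 \<le> real n * h x" for x
  proof (cases "\<bar>x\<bar> \<le> real n")
    case True
    then have "x\<^sup>2 \<le> real n * real n"
      using power_mono[of "\<bar>x\<bar>" "real n" 2] by (simp add: power2_eq_square)
    then show ?thesis
      using npos True by (auto simp: t_def h_def min_def)
  qed (use npos h_nonneg in \<open>auto simp: t_def\<close>)
  have tail: "real n * indicator {x. \<bar>x\<bar> > real n} x \<le> h x" for x
  proof (cases "\<bar>x\<bar> > real n")
    case True
    then have "real n * real n \<le> x\<^sup>2"
      using power_mono[of "real n" "\<bar>x\<bar>" 2] npos by (simp add: power2_eq_square)
    then show ?thesis
      using npos True by (auto simp: h_def field_simps)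
  qed (use h_nonneg in auto)

  define T where "T \<omega> = (\<Sum>i=1..n. t (X i \<omega>))" for \<omega>
  have [measurable]: "random_variable borel T"
    unfolding T_def by (intro borel_measurable_sum measurable_compose[OF _ t_meas]) auto
  have int_t: "integrable M (\<lambda>\<omega>. t (X i \<omega>))" if "i \<ge> 1" for i
    using that bound_t by (intro integrable_const_bound[of _ "real n"]) auto
  have int_t2: "integrable M (\<lambda>\<omega>. (t (X i \<omega>))\<^sup>2)" if "i \<ge> 1" for i
    using that bound_t
    by (intro integrable_const_bound[of _ "(real n)\<^sup>2"])
       (auto intro!: AE_I2 simp: abs_le_square_iff[symmetric])
  have indep_t: "indep_vars (\<lambda>_. borel) (\<lambda>i \<omega>. t (X i \<omega>)) {1..n}"
    by (intro indep_vars_compose2[OF indep_vars_subset[OF indep]]) auto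
  have exp_T: "expectation T = real n * expectation (\<lambda>\<omega>. t (X 1 \<omega>))"
  proof -
    have "expectation T = (\<Sum>i=1..n. expectation (\<lambda>\<omega>. t (X i \<omega>)))"
      unfolding T_def by (intro Bochner_Integration.integral_sum int_t) auto
    also have "\<dots> = (\<Sum>i=1..n. expectation (\<lambda>\<omega>. t (X 1 \<omega>)))"
      by (intro sum.cong refl expectation_ident[of _ t]) auto
    finally show ?thesis
      by simp
  qed
  have "variance T = (\<Sum>i=1..n. variance (\<lambda>\<omega>. t (X i \<omega>)))"
    unfolding T_def using int_t2 by (intro variance_sum_indep indep_t) auto
  also have "\<dots> \<le> (\<Sum>i=1..n. expectation (\<lambda>\<omega>. (t (X i \<omega>))\<^sup>2))"
    using int_t int_t2 by (intro sum_mono) (subst variance_eq, auto)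
  also have "\<dots> = (\<Sum>i=1..n. expectation (\<lambda>\<omega>. (t (X 1 \<omega>))\<^sup>2))"
    by (intro sum.cong refl expectation_ident[of _ "\<lambda>x. (t x)\<^sup>2"]) auto
  also have "\<dots> \<le> (\<Sum>i=1..n. expectation (\<lambda>\<omega>. real n * h (X 1 \<omega>)))"
    using int_t2[of 1] int_h t_sq by (intro sum_mono integral_mono) auto
  also have "\<dots> = (real n)\<^sup>2 * expectation (\<lambda>\<omega>. h (X 1 \<omega>))"
    by (simp add: power2_eq_square)
  finally have var_T: "variance T \<le> (real n)\<^sup>2 * expectation (\<lambda>\<omega>. h (X 1 \<omega>))" .

  define A where "A = {\<omega> \<in> space M. \<bar>T \<omega> - expectation T\<bar> \<ge> e * real n}"
  define B where "B i = {\<omega> \<in> space M. \<bar>X i \<omega>\<bar> > real n}" for i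
  have [measurable]: "A \<in> events"
    unfolding A_def by measurable
  have B_meas: "B i \<in> events" if "i \<ge> 1" for i
    using rv[OF that] unfolding B_def by measurable
  have sq_T: "integrable M (\<lambda>\<omega>. (T \<omega>)\<^sup>2)"
    unfolding T_def using int_t2 by (intro integrable_sum_power2_indep indep_t) auto
  have "prob A \<le> variance T / (e * real n)\<^sup>2"
    unfolding A_def using e npos sq_T by (intro Chebyshev_inequality) auto
  also have "\<dots> \<le> (real n)\<^sup>2 * expectation (\<lambda>\<omega>. h (X 1 \<omega>)) / (e * real n)\<^sup>2"
    using var_T by (intro divide_right_mono) auto
  also have "\<dots> = 1 / e\<^sup>2 * expectation (\<lambda>\<omega>. h (X 1 \<omega>))"
    using npos by (simp add: power_mult_distrib)
  finally have prob_A: "prob A \<le> 1 / e\<^sup>2 * expectation (\<lambda>\<omega>. h (X 1 \<omega>))" .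

  \<comment> \<open>Integrating the tail inequality gains a factor \<open>real n\<close>, which is
    exactly what the union bound over \<open>n\<close> events loses.\<close>
  have prob_B: "real n * prob (B i) \<le> expectation (\<lambda>\<omega>. h (X 1 \<omega>))" if i: "i \<ge> 1" for i
  proof -
    have int_h_i: "integrable M (\<lambda>\<omega>. h (X i \<omega>))"
      by (rule integrable_const_bound[of _ "real n"]) (use h_nonneg i in \<open>auto simp: h_def\<close>)
    have "real n * prob (B i) = expectation (\<lambda>\<omega>. real n * indicator (B i) \<omega>)"
      using B_meas[OF i] by simp
    also have "\<dots> \<le> expectation (\<lambda>\<omega>. h (X i \<omega>))"
    proof (rule integral_mono[OF _ int_h_i])
      fix \<omega> assume "\<omega> \<in> space M"
      then show "real n * indicator (B i) \<omega> \<le> h (X i \<omega>)"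
        using tail[of "X i \<omega>"] by (auto simp: B_def indicator_def)
    qed (use B_meas[OF i] in \<open>auto simp: emeasure_eq_measure\<close>)
    also have "\<dots> = expectation (\<lambda>\<omega>. h (X 1 \<omega>))"
      using i by (intro expectation_ident[of _ h]) auto
    finally show ?thesis .
  qed
  have "prob (\<Union>i\<in>{1..n}. B i) \<le> (\<Sum>i=1..n. prob (B i))"
    using B_meas by (intro finite_measure_subadditive_finite) auto
  also have "\<dots> \<le> (\<Sum>i=1..n. expectation (\<lambda>\<omega>. h (X 1 \<omega>)) / real n)"
    using prob_B npos by (intro sum_mono) (auto simp: field_simps)
  also have "\<dots> = expectation (\<lambda>\<omega>. h (X 1 \<omega>))"
    using npos by simp
  finally have prob_UB: "prob (\<Union>i\<in>{1..n}. B i) \<le> expectation (\<lambda>\<omega>. h (X 1 \<omega>))" .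

  have "prob {\<omega> \<in> space M. \<bar>(\<Sum>i=1..n. X i \<omega>) / real n - expectation (\<lambda>\<omega>. t (X 1 \<omega>))\<bar> \<ge> e}
      \<le> prob (A \<union> (\<Union>i\<in>{1..n}. B i))"
  proof (rule finite_measure_mono)
    show "A \<union> (\<Union>i\<in>{1..n}. B i) \<in> events"
      using B_meas by (intro sets.Un sets.finite_UN) auto
    show "{\<omega> \<in> space M. \<bar>(\<Sum>i=1..n. X i \<omega>) / real n - expectation (\<lambda>\<omega>. t (X 1 \<omega>))\<bar> \<ge> e}
        \<subseteq> A \<union> (\<Union>i\<in>{1..n}. B i)"
    proof
      fix \<omega> assume \<omega>: "\<omega> \<in> {\<omega> \<in> space M.
        \<bar>(\<Sum>i=1..n. X i \<omega>) / real n - expectation (\<lambda>\<omega>. t (X 1 \<omega>))\<bar> \<ge> e}"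
      show "\<omega> \<in> A \<union> (\<Union>i\<in>{1..n}. B i)"
      proof (cases "\<omega> \<in> (\<Union>i\<in>{1..n}. B i)")
        case False
        \<comment> \<open>Off the exceptional events truncation changes none of the first
          \<open>n\<close> variables, so a large deviation of the average is one of
          \<open>T\<close>.\<close>
        then have "T \<omega> = (\<Sum>i=1..n. X i \<omega>)"
          using \<omega> unfolding T_def by (intro sum.cong) (auto simp: B_def t_def not_less)
        then have "T \<omega> - expectation T
            = real n * ((\<Sum>i=1..n. X i \<omega>) / real n - expectation (\<lambda>\<omega>. t (X 1 \<omega>)))"
          using npos by (simp add: exp_T right_diff_distrib)
        then have "\<bar>T \<omega> - expectation T\<bar> \<ge> e * real n"
          using \<omega> npos by (simp add: abs_mult)
        then show ?thesis
          using \<omega> by (simp add: A_def)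
      qed simp
    qed
  qed
  also have "\<dots> \<le> prob A + prob (\<Union>i\<in>{1..n}. B i)"
    using B_meas by (intro measure_Un_le sets.finite_UN) auto
  also have "\<dots> \<le> (1 + 1 / e\<^sup>2) * expectation (\<lambda>\<omega>. h (X 1 \<omega>))"
    using prob_A prob_UB by (simp add: distrib_right)
  finally show ?thesis
    by (simp add: h_def)
qed

text \<open>Dominated convergence with bound |Y|; it later replaces the truncated centering by the
  true mean.\<close>

lemma expectation_truncate_tendsto:
  fixes Y :: "'a \<Rightarrow> real"
  assumes "integrable M Y"
  shows "(\<lambda>n. expectation (\<lambda>\<omega>. if \<bar>Y \<omega>\<bar> \<le> real n then Y \<omega> else 0)) \<longlonglongrightarrow> expectation Y"
proof (rule integral_dominated_convergence[where w = "\<lambda>\<omega>. \<bar>Y \<omega>\<bar>"])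
  have [measurable]: "random_variable borel Y"
    using assms by auto
  show "random_variable borel (\<lambda>\<omega>. if \<bar>Y \<omega>\<bar> \<le> real n then Y \<omega> else 0)" for n
    by measurable
  show "AE \<omega> in M. (\<lambda>n. if \<bar>Y \<omega>\<bar> \<le> real n then Y \<omega> else 0) \<longlonglongrightarrow> Y \<omega>"
  proof (intro AE_I2)
    fix \<omega>
    have "\<forall>\<^sub>F n in sequentially. \<bar>Y \<omega>\<bar> \<le> real n"
      using filterlim_real_sequentially by (simp add: filterlim_at_top)
    then show "(\<lambda>n. if \<bar>Y \<omega>\<bar> \<le> real n then Y \<omega> else 0) \<longlonglongrightarrow> Y \<omega>"
      by (rule tendsto_eventually[OF eventually_mono]) simp
  qed
qed (use assms in auto)

section \<open>Almost sure convergence, along subsequences and in full\<close>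

lemma iid_average_ceil_pow_tendsto:
  fixes X :: "nat \<Rightarrow> 'a \<Rightarrow> real"
  assumes indep: "indep_vars (\<lambda>_. borel) X {1..}"
    and ident: "\<And>n. n \<ge> 1 \<Longrightarrow> distr M borel (X n) = distr M borel (X 1)"
    and int: "integrable M (X 1)" and a: "a > 1"
  shows "AE \<omega> in M. (\<lambda>n. (\<Sum>i=1..ceil_pow a n. X i \<omega>) / real (ceil_pow a n))
    \<longlonglongrightarrow> expectation (X 1)"
proof -
  define k where "k = ceil_pow a"
  define m where "m n = expectation (\<lambda>\<omega>. if \<bar>X 1 \<omega>\<bar> \<le> real n then X 1 \<omega> else 0)" for n
  define D where "D \<omega> n = \<bar>(\<Sum>i=1..k n. X i \<omega>) / real (k n) - m (k n)\<bar>" for \<omega> n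
  have rv: "random_variable borel (X i)" if "i \<ge> 1" for i
    using indep that by (auto simp: indep_vars_def)
  have [measurable]: "random_variable borel (X 1)" "random_variable borel (X (Suc 0))"
    using rv[of 1] by auto
  have [measurable]: "random_variable borel (\<lambda>\<omega>. D \<omega> n)" for n
    unfolding D_def using rv by (intro borel_measurable_abs borel_measurable_diff
        borel_measurable_divide borel_measurable_sum) auto
  define q where "q n = expectation (\<lambda>\<omega>. min (real (k n)) ((X 1 \<omega>)\<^sup>2 / real (k n)))" for n
  have int_q: "integrable M (\<lambda>\<omega>. min (real (k n)) ((X 1 \<omega>)\<^sup>2 / real (k n)))" for n
    by (rule integrable_const_bound[of _ "real (k n)"]) auto
  \<comment> \<open>The finite mean enters here: exchanging the finite sum with the expectation and
    applying the pointwise bound gives partial sums at most a constant times E|X_1|.\<close>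
  have "summable q"
  proof (rule summableI_nonneg_bounded)
    show "0 \<le> q n" for n
      unfolding q_def by (intro Bochner_Integration.integral_nonneg) auto
    fix N
    have "(\<Sum>n<N. q n) = expectation (\<lambda>\<omega>. \<Sum>n<N. min (real (k n)) ((X 1 \<omega>)\<^sup>2 / real (k n)))"
      unfolding q_def using int_q by (intro Bochner_Integration.integral_sum[symmetric]) auto
    also have "\<dots> \<le> expectation (\<lambda>\<omega>. 4 * (a + 1) / (a - 1) * \<bar>X 1 \<omega>\<bar>)"
      unfolding k_def using int_q int sum_min_ceil_pow_le[OF a]
      by (intro integral_mono) (auto simp: k_def simp del: times_divide_eq_left)
    finally show "(\<Sum>n<N. q n) \<le> expectation (\<lambda>\<omega>. 4 * (a + 1) / (a - 1) * \<bar>X 1 \<omega>\<bar>)" .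
  qed
  \<comment> \<open>Only countably many thresholds are used, so the exceptional null sets from
    Borel-Cantelli combine into one, outside which \<open>D\<close> tends to 0.\<close>
  have "AE \<omega> in M. \<forall>j. \<forall>\<^sub>F n in sequentially. D \<omega> n < 1 / real (Suc j)"
    unfolding AE_all_countable
  proof
    fix j
    define e where "e = 1 / real (Suc j)"
    have e: "e > 0"
      by (simp add: e_def)
    have "prob {\<omega> \<in> space M. D \<omega> n \<ge> e} \<le> (1 + 1 / e\<^sup>2) * q n" for n
      unfolding D_def q_def m_def using ceil_pow_bounds(4)[OF a]
      by (intro iid_average_deviation indep ident e) (auto simp: k_def)
    then have "summable (\<lambda>n. prob {\<omega> \<in> space M. D \<omega> n \<ge> e})"
      using \<open>summable q\<close> by (auto intro: summable_comparison_test'[OF summable_mult[of q "1 + 1 / e\<^sup>2"]])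
    then have "AE \<omega> in M. \<forall>\<^sub>F n in sequentially. \<omega> \<in> space M - {\<omega> \<in> space M. D \<omega> n \<ge> e}"
      by (intro borel_cantelli_AE1) (auto simp: emeasure_eq_measure)
    then show "AE \<omega> in M. \<forall>\<^sub>F n in sequentially. D \<omega> n < 1 / real (Suc j)"
      by (rule eventually_mono) (auto simp: e_def not_le elim: eventually_mono)
  qed
  then show ?thesis
  proof (rule eventually_mono)
    fix \<omega> assume ev: "\<forall>j. \<forall>\<^sub>F n in sequentially. D \<omega> n < 1 / real (Suc j)"
    have "D \<omega> \<longlonglongrightarrow> 0"
    proof (rule order_tendstoI)
      fix b :: real assume "b > 0"
      then obtain j where "1 / real (Suc j) < b"
        using nat_approx_posE by blast
      then show "\<forall>\<^sub>F n in sequentially. D \<omega> n < b"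
        using spec[OF ev, of j] by (auto elim: eventually_mono)
    qed (auto simp: D_def intro!: always_eventually)
    then have "(\<lambda>n. (\<Sum>i=1..k n. X i \<omega>) / real (k n) - m (k n)) \<longlonglongrightarrow> 0"
      unfolding D_def by (simp add: tendsto_rabs_zero_iff)
    moreover have "(\<lambda>n. m (k n)) \<longlonglongrightarrow> expectation (X 1)"
      using expectation_truncate_tendsto[OF int] filterlim_ceil_pow[OF a]
      unfolding m_def k_def by (rule filterlim_compose)
    ultimately have "(\<lambda>n. ((\<Sum>i=1..k n. X i \<omega>) / real (k n) - m (k n)) + m (k n))
        \<longlonglongrightarrow> 0 + expectation (X 1)"
      by (rule tendsto_add)
    then show "(\<lambda>n. (\<Sum>i=1..ceil_pow a n. X i \<omega>) / real (ceil_pow a n)) \<longlonglongrightarrow> expectation (X 1)"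
      by (simp add: k_def)
  qed
qed

text \<open>The null sets for the countably many ratios are merged first; then the deterministic
  gap-filling argument applies to each remaining outcome, since nonnegative summands make the
  partial sums monotone.\<close>

lemma iid_average_tendsto_nonneg:
  fixes X :: "nat \<Rightarrow> 'a \<Rightarrow> real"
  assumes indep: "indep_vars (\<lambda>_. borel) X {1..}"
    and ident: "\<And>n. n \<ge> 1 \<Longrightarrow> distr M borel (X n) = distr M borel (X 1)"
    and int: "integrable M (X 1)" and nonneg: "\<And>i \<omega>. X i \<omega> \<ge> 0"
  shows "AE \<omega> in M. (\<lambda>n. (\<Sum>i=1..n. X i \<omega>) / real n) \<longlonglongrightarrow> expectation (X 1)"
proof -
  have "AE \<omega> in M. \<forall>j. (\<lambda>n. (\<Sum>i=1..ceil_pow (1 + 1 / real (Suc j)) n. X i \<omega>)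
      / real (ceil_pow (1 + 1 / real (Suc j)) n)) \<longlonglongrightarrow> expectation (X 1)"
    unfolding AE_all_countable
    by (intro allI iid_average_ceil_pow_tendsto[OF indep ident int]) auto
  then show ?thesis
    by (rule eventually_mono)
       (rule mono_average_tendsto, auto intro!: monoI sum_mono2 sum_nonneg nonneg)
qed

end

section \<open>Reduction to nonnegative variables\<close>

theorem theorem2:
  fixes M :: "'a measure" and X :: "nat \<Rightarrow> 'a \<Rightarrow> real"
  assumes "prob_space M"
    and indep: "prob_space.indep_vars M (\<lambda>_. borel) X {1..}"
    and ident: "\<And>n. n \<ge> 1 \<Longrightarrow> distr M borel (X n) = distr M borel (X 1)"
    and finite_mean: "integrable M (X 1)"
  shows "AE \<omega> in M. (\<lambda>n. (\<Sum>i=1..n. X i \<omega>) / real n) \<longlonglongrightarrow> prob_space.expectation M (X 1)"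
proof -
  interpret prob_space M
    by fact
  have rv: "random_variable borel (X i)" if "i \<ge> 1" for i
    using indep that by (auto simp: indep_vars_def)
  \<comment> \<open>Applying one fixed Borel function to every variable preserves independence and
    equality of laws, so the nonnegative case covers the positive and the negative parts
    alike.\<close>
  have lim: "AE \<omega> in M. (\<lambda>n. (\<Sum>i=1..n. f (X i \<omega>)) / real n) \<longlonglongrightarrow> expectation (\<lambda>\<omega>. f (X 1 \<omega>))"
    if [measurable]: "f \<in> borel_measurable borel"
      and "integrable M (\<lambda>\<omega>. f (X 1 \<omega>))" "\<And>x. f x \<ge> 0" for f :: "real \<Rightarrow> real"
  proof (rule iid_average_tendsto_nonneg)
    show "indep_vars (\<lambda>_. borel) (\<lambda>i \<omega>. f (X i \<omega>)) {1..}"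
      by (intro indep_vars_compose2[OF indep]) auto
    show "distr M borel (\<lambda>\<omega>. f (X n \<omega>)) = distr M borel (\<lambda>\<omega>. f (X 1 \<omega>))" if "n \<ge> 1" for n
    proof -
      \<comment> \<open>The law of \<open>f (X i)\<close> is the image under \<open>f\<close> of the
        law of \<open>X i\<close>, hence the same for all \<open>i \<ge> 1\<close>.\<close>
      have "distr M borel (\<lambda>\<omega>. f (X i \<omega>)) = distr (distr M borel (X i)) borel f" if "i \<ge> 1" for i
        using rv[OF that] by (subst distr_distr) (auto simp: comp_def)
      then show ?thesis
        using ident[OF that] that by simp
    qed
  qed (use that in auto)
  have pos: "integrable M (\<lambda>\<omega>. max 0 (X 1 \<omega>))" and neg: "integrable M (\<lambda>\<omega>. max 0 (- X 1 \<omega>))"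
    using finite_mean by auto
  have split: "max 0 x - max 0 (- x) = x" for x :: real
    by auto
  have "AE \<omega> in M. (\<lambda>n. (\<Sum>i=1..n. max 0 (X i \<omega>)) / real n) \<longlonglongrightarrow> expectation (\<lambda>\<omega>. max 0 (X 1 \<omega>))"
    using pos by (intro lim) auto
  moreover have "AE \<omega> in M. (\<lambda>n. (\<Sum>i=1..n. max 0 (- X i \<omega>)) / real n)
      \<longlonglongrightarrow> expectation (\<lambda>\<omega>. max 0 (- X 1 \<omega>))"
    using neg by (intro lim[of "\<lambda>x. max 0 (- x)"]) auto
  ultimately show ?thesis
  proof eventually_elim
    case (elim \<omega>)
    have "expectation (\<lambda>\<omega>. max 0 (X 1 \<omega>)) - expectation (\<lambda>\<omega>. max 0 (- X 1 \<omega>)) = expectation (X 1)"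
      unfolding Bochner_Integration.integral_diff[OF pos neg, symmetric] split ..
    with tendsto_diff[OF elim] show ?case
      by (simp add: split flip: diff_divide_distrib sum_subtractf)
  qed
qed

end
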